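(* Let $r\ge 1$ be an integer and define the polynomials $$Q_r(z)=\frac{(-1)^r}{(r-1)!}\sum_{l=1}^{r}\frac{{}_rS_l}{l}\left\{z^l-(-1)^lB_l\right\},\qquad \psi_r(z)=\binom{z}{r}+\sum_{j=0}^{r-1}\frac{B_{j+1}}{j+1}\,G_{r,j}(z-1).$$ Then for all $z\in\mathbb{C}$, $$Q_r(z)=(-1)^r\,\psi_r(z).$$
   Context: For $z\in\mathbb{C}$ and an integer $k\ge 0$, $\binom{z}{k}=\frac{z(z-1)\cdots(z-k+1)}{k!}$ (with $\binom{z}{0}=1$). The Stirling numbers of the first kind ${}_rS_j$ are defined by $t(t-1)\cdots(t-r+1)=\sum_{j=0}^{r}{}_rS_j\,t^j$. The polynomials $G_{r,j}(z)$, $0\le j\le r-1$, are defined by the polynomial identity in $u$ $$\binom{z-u}{r-1}=\sum_{j=0}^{r-1}G_{r,j}(z)\,u^j .$$ The Bernoulli numbers $B_n$ are defined by $\frac{t}{e^t-1}=\sum_{n\ge 0}B_n\frac{t^n}{n!}$ (so $B_1=-\tfrac12$). *)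

theory Defs
  imports Complex_Main "HOL-Computational_Algebra.Computational_Algebra"
begin

lemma poly_eq_sum_atMost:
  fixes p :: "'a::comm_semiring_1 poly"
  assumes "degree p \<le> n"
  shows "poly p x = (\<Sum>j\<le>n. coeff p j * x ^ j)"
  unfolding poly_altdef using assms
  by (intro sum.mono_neutral_left) (auto simp: coeff_eq_0)

text \<open>The convention \<open>B\<^sub>1 = -1/2\<close>; the quotient is taken in the ring of formal power series.\<close>

definition bernoulli :: "nat \<Rightarrow> complex" where
  "bernoulli n = fact n * fps_nth (fps_X / (fps_exp 1 - 1)) n"

lemma bernoulli_generating_function:
  "Abs_fps (\<lambda>n. bernoulli n / fact n) * (fps_exp 1 - 1) = fps_X"
proof -
  have nz: "fps_exp (1::complex) - 1 \<noteq> 0"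
  proof
    assume "fps_exp (1::complex) - 1 = 0"
    hence "fps_nth (fps_exp (1::complex) - 1) 1 = 0" by simp
    thus False by simp
  qed
  have "subdegree (fps_exp (1::complex) - 1) = 1"
    by (rule subdegreeI) auto
  hence "fps_exp (1::complex) - 1 dvd fps_X"
    using nz by (subst fps_dvd_iff) auto
  moreover have "Abs_fps (\<lambda>n. bernoulli n / fact n) = fps_X / (fps_exp 1 - 1)"
    by (rule fps_ext) (simp add: bernoulli_def)
  ultimately show ?thesis by simp
qed

text \<open>Signed Stirling numbers of the first kind, with \<open>t\<close> the variable \<open>[:0, 1:]\<close>.\<close>

definition signed_stirling :: "nat \<Rightarrow> nat \<Rightarrow> complex" where
  "signed_stirling r j = coeff (\<Prod>i<r. [:0, 1:] - of_nat i) j"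

lemma signed_stirling_expansion:
  "(\<Prod>i<r. t - of_nat i) = (\<Sum>j\<le>r. signed_stirling r j * t ^ j)"
proof -
  let ?p = "(\<Prod>i<r. [:0, 1:] - of_nat i) :: complex poly"
  have lin: "degree ([:0, 1:] - of_nat i :: complex poly) = 1" for i
    by (simp add: of_nat_poly)
  have "degree ?p \<le> (\<Sum>i<r. degree ([:0, 1:] - of_nat i :: complex poly))"
    using degree_prod_sum_le[of "{..<r}" "\<lambda>i. [:0, 1:] - of_nat i :: complex poly"]
    by (simp add: o_def)
  hence deg: "degree ?p \<le> r" by (simp only: lin) simp
  have "(\<Prod>i<r. t - of_nat i) = poly ?p t"
    by (simp add: poly_prod of_nat_poly)
  also have "\<dots> = (\<Sum>j\<le>r. coeff ?p j * t ^ j)"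
    using deg by (rule poly_eq_sum_atMost)
  finally show ?thesis by (simp add: signed_stirling_def)
qed

text \<open>
  For fixed \<open>z\<close>, the linear polynomial \<open>z - u\<close> in \<open>u\<close> is \<open>[:z, -1:]\<close>. The operator \<open>gchoose\<close> is not
  available on polynomials, so the binomial coefficient is written out.
\<close>

definition G :: "nat \<Rightarrow> nat \<Rightarrow> complex \<Rightarrow> complex" where
  "G r j z = coeff (smult (1 / fact (r - 1)) (\<Prod>i<r - 1. [:z, -1:] - of_nat i)) j"

lemma G_expansion:
  "(z - u) gchoose (r - 1) = (\<Sum>j = 0..r - 1. G r j z * u ^ j)"
proof -
  define k where "k = r - 1"
  let ?q = "(\<Prod>i<k. [:z, -1:] - of_nat i) :: complex poly"
  have lin: "degree ([:z, -1:] - of_nat i :: complex poly) = 1" for i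
    by (simp add: of_nat_poly)
  have "degree ?q \<le> (\<Sum>i<k. degree ([:z, -1:] - of_nat i :: complex poly))"
    using degree_prod_sum_le[of "{..<k}" "\<lambda>i. [:z, -1:] - of_nat i :: complex poly"]
    by (simp add: o_def)
  hence deg: "degree (smult (1 / fact k) ?q) \<le> k"
    by (simp only: lin degree_smult_eq) simp
  have "(z - u) gchoose k = poly (smult (1 / fact k) ?q) u"
    by (simp add: gbinomial_prod_rev poly_prod of_nat_poly algebra_simps atLeast0LessThan)
  also have "\<dots> = (\<Sum>j\<le>k. coeff (smult (1 / fact k) ?q) j * u ^ j)"
    using deg by (rule poly_eq_sum_atMost)
  finally show ?thesis by (simp add: k_def G_def atLeast0AtMost)
qed

definition Q :: "nat \<Rightarrow> complex \<Rightarrow> complex" where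
  "Q r z = (-1) ^ r / fact (r - 1) *
     (\<Sum>l = 1..r. signed_stirling r l / of_nat l * (z ^ l - (-1) ^ l * bernoulli l))"

definition psi :: "nat \<Rightarrow> complex \<Rightarrow> complex" where
  "psi r z = (z gchoose r) +
     (\<Sum>j = 0..r - 1. bernoulli (j + 1) / of_nat (j + 1) * G r j (z - 1))"

end

theory Submission
  imports Defs
begin

text \<open>
  Write \<open>P(t) = t(t-1)\<dots>(t-r+1)\<close> and \<open>S\<^sub>l\<close> for its coefficients, the Stirling numbers. Let \<open>\<beta>\<^sub>l\<close> be
  the shifted Bernoulli polynomial \<open>\<beta>\<^sub>l(z) = B\<^sub>l(z+1)\<close>, whose constant term is \<open>(-1)\<^sup>l B\<^sub>l\<close>.

  Multiplying \<open>(z-1-u gchoose r-1)\<close> by \<open>z - u\<close> turns it into \<open>P(z-u) / (r-1)!\<close>. Hence it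
  equals \<open>1/(r-1)! \<Sum>\<^sub>l S\<^sub>l (z-u)\<^bsup>l-1\<^esup>\<close>. The Bernoulli sum in \<open>psi\<close> is obtained from it by replacing
  each \<open>u\<^sup>j\<close> by \<open>B\<^bsub>j+1\<^esub>/(j+1)\<close>. This replacement is linear, and it sends \<open>(z-u)\<^bsup>l-1\<^esup>\<close> to
  \<open>(z\<^sup>l - \<beta>\<^sub>l(z))/l\<close> (lemma \<open>bernoulli_functional_power\<close>). Comparing with \<open>Q\<close>, whose \<open>l\<close>-th term
  contains \<open>z\<^sup>l - \<beta>\<^sub>l(0)\<close>, what remains is
  \[ P(z)/r = \sum_{l=1}^r S_l\,(\beta_l(z)-\beta_l(0))/l. \]
  Both sides vanish at \<open>0\<close>, and both have the backward difference \<open>P(z)/z\<close>: on the left by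
  taking out the factors that \<open>P(z)\<close> and \<open>P(z-1)\<close> share, on the right because \<open>\<beta>\<^sub>l(z) - \<beta>\<^sub>l(z-1) = l z\<^bsup>l-1\<^esup>\<close>. Polynomials with
  these two properties coincide (lemma \<open>poly_eq_if_diff_eq\<close>).
\<close>

text \<open>This is \<open>B\<^sub>l(z+1)\<close>. The alternating sign stands in for the shift, by the reflection
  \<open>B\<^sub>l(z+1) = (-1)\<^sup>l B\<^sub>l(-z)\<close>; this makes the constant term visibly the one that occurs in \<open>Q\<close>.\<close>

definition bernoulli_shift_poly :: "nat \<Rightarrow> complex poly" where
  "bernoulli_shift_poly l = (\<Sum>m\<le>l. monom (of_nat (l choose m) * (-1) ^ m * bernoulli m) (l - m))"

lemma poly_bernoulli_shift_poly:
  "poly (bernoulli_shift_poly l) z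
     = (\<Sum>m\<le>l. of_nat (l choose m) * (-1) ^ m * bernoulli m * z ^ (l - m))"
  by (simp add: bernoulli_shift_poly_def poly_sum poly_monom)

lemma poly_bernoulli_shift_poly_0: "poly (bernoulli_shift_poly l) 0 = (-1) ^ l * bernoulli l"
proof -
  have "poly (bernoulli_shift_poly l) 0
      = (\<Sum>m\<le>l. if m = l then (-1) ^ l * bernoulli l else 0)"
    unfolding poly_bernoulli_shift_poly by (intro sum.cong) (auto simp: power_0_left)
  thus ?thesis by simp
qed

text \<open>Substitute \<open>-t\<close> for \<open>t\<close> in the generating function of the Bernoulli numbers.\<close>

lemma signed_bernoulli_generating_function:
  "Abs_fps (\<lambda>n. (-1) ^ n * bernoulli n / fact n) * (1 - fps_exp (-1)) = fps_X"
proof -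
  have "(Abs_fps (\<lambda>n. bernoulli n / fact n) * (fps_exp 1 - 1)) oo (fps_const (-1) * fps_X)
      = fps_X oo (fps_const (-1) * fps_X)"
    by (simp only: bernoulli_generating_function)
  hence "(Abs_fps (\<lambda>n. bernoulli n / fact n) oo (fps_const (-1) * fps_X)) * (fps_exp (-1) - 1)
      = - fps_X"
    by (simp add: fps_compose_mult_distrib fps_compose_sub_distrib fps_exp_compose_linear
          del: fps_const_neg)
  moreover have "Abs_fps (\<lambda>n. bernoulli n / fact n) oo (fps_const (-1) * fps_X)
      = Abs_fps (\<lambda>n. (-1) ^ n * bernoulli n / fact n)"
    by (simp add: fps_compose_linear fps_eq_iff)
  ultimately show ?thesis by (simp add: algebra_simps)
qed

lemma bernoulli_shift_poly_generating_function:
  "Abs_fps (\<lambda>n. (-1) ^ n * bernoulli n / fact n) * fps_exp z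
     = Abs_fps (\<lambda>l. poly (bernoulli_shift_poly l) z / fact l)"
  unfolding fps_eq_iff fps_mult_nth poly_bernoulli_shift_poly
  by (auto simp: sum_divide_distrib atLeast0AtMost binomial_fact intro!: sum.cong)

text \<open>Passing to the difference multiplies the generating function by \<open>1 - e\<^bsup>-t\<^esup>\<close>. This cancels
  the denominator in the generating function of the signed Bernoulli numbers and leaves
  \<open>t e\<^bsup>zt\<^esup>\<close>.\<close>

lemma bernoulli_shift_poly_diff:
  assumes "l \<ge> 1"
  shows "poly (bernoulli_shift_poly l) z - poly (bernoulli_shift_poly l) (z - 1)
           = of_nat l * z ^ (l - 1)"
proof -
  let ?H = "Abs_fps (\<lambda>n. (-1) ^ n * bernoulli n / fact n)"
  obtain k where k: "l = Suc k" using assms by (cases l) auto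
  have "?H * fps_exp z - ?H * fps_exp (z - 1) = ?H * (1 - fps_exp (-1)) * fps_exp z"
    using fps_exp_add_mult[of z "-1"] by (simp add: algebra_simps)
  also have "\<dots> = fps_X * fps_exp z"
    by (simp only: signed_bernoulli_generating_function)
  finally have "fps_nth (?H * fps_exp z - ?H * fps_exp (z - 1)) l = fps_nth (fps_X * fps_exp z) l"
    by simp
  hence "poly (bernoulli_shift_poly l) z / fact l - poly (bernoulli_shift_poly l) (z - 1) / fact l
      = z ^ k / fact k"
    by (simp add: bernoulli_shift_poly_generating_function k del: fact_Suc)
  hence "(poly (bernoulli_shift_poly l) z - poly (bernoulli_shift_poly l) (z - 1)) / fact l
      = of_nat l * z ^ k / fact l"
    by (simp add: diff_divide_distrib k del: of_nat_Suc)
  thus ?thesis by (simp add: k del: fact_Suc)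
qed

text \<open>The values at the natural numbers are determined by the differences, and they are infinitely
  many.\<close>

lemma poly_eq_if_diff_eq:
  fixes p q :: "'a::{idom, ring_char_0} poly"
  assumes diff: "\<And>x. poly p x - poly p (x - 1) = poly q x - poly q (x - 1)"
    and "poly p 0 = poly q 0"
  shows "p = q"
proof (rule ccontr)
  assume "p \<noteq> q"
  hence "finite {x. poly (p - q) x = 0}" by (intro poly_roots_finite) simp
  moreover have "poly p (of_nat n) = poly q (of_nat n)" for n
  proof (induction n)
    case (Suc n)
    show ?case using diff[of "of_nat (Suc n)"] Suc by simp
  qed (simp add: assms)
  hence "range of_nat \<subseteq> {x. poly (p - q) x = 0}" by auto
  ultimately have "finite (range (of_nat :: nat \<Rightarrow> 'a))" by (rule finite_subset[rotated])
  thus False using finite_imageD[OF _ inj_of_nat] by blast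
qed

lemma signed_stirling_0:
  assumes "r \<ge> 1"
  shows "signed_stirling r 0 = 0"
proof -
  have "signed_stirling r 0 = poly (\<Prod>i<r. [:0, 1:] - of_nat i) 0"
    by (simp add: signed_stirling_def poly_0_coeff_0)
  also have "\<dots> = 0" using assms by (simp add: poly_prod of_nat_poly prod_zero_iff)
  finally show ?thesis .
qed

text \<open>This is \<open>P(z-u)/(z-u)\<close> as a polynomial in \<open>u\<close>. Values at points cannot give it directly, as the
  quotient is undefined at \<open>u = z\<close>; so the factor \<open>z - u\<close> is cancelled in the ring of polynomials.\<close>

lemma prod_shifted_factorial_eq_sum_poly:
  fixes z :: complex
  assumes "r \<ge> 1"
  shows "(\<Prod>i<r - 1. [:z - 1, -1:] - of_nat i)
           = (\<Sum>l = 1..r. smult (signed_stirling r l) ([:z, -1:] ^ (l - 1)))"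
    (is "?L = ?R")
proof -
  obtain k where k: "r = Suc k" using assms by (cases r) auto
  have "poly ([:z, -1:] * ?L) u = poly ([:z, -1:] * ?R) u" for u
  proof -
    have "poly ([:z, -1:] * ?L) u = (\<Prod>i<r. (z - u) - of_nat i)"
      unfolding k prod.lessThan_Suc_shift
      by (simp add: poly_prod of_nat_poly algebra_simps)
    also have "\<dots> = (\<Sum>l\<le>r. signed_stirling r l * (z - u) ^ l)"
      by (rule signed_stirling_expansion)
    also have "\<dots> = (\<Sum>l = 1..r. signed_stirling r l * (z - u) ^ l)"
      using signed_stirling_0[OF assms]
      by (intro sum.mono_neutral_right) (auto simp: not_le)
    also have "\<dots> = (\<Sum>l = 1..r. (z - u) * (signed_stirling r l * (z - u) ^ (l - 1)))"
      by (intro sum.cong refl) (auto simp: power_eq_if)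
    also have "\<dots> = (z - u) * poly ?R u"
      by (simp add: poly_sum sum_distrib_left)
    also have "\<dots> = poly ([:z, -1:] * ?R) u" by (simp add: left_diff_distrib)
    finally show ?thesis .
  qed
  hence "[:z, -1:] * ?L = [:z, -1:] * ?R" 
    by (intro iffD1[OF poly_eq_poly_eq_iff] ext)
  thus ?thesis by (subst (asm) mult_cancel_left) auto
qed

corollary prod_pred_eq_sum_stirling:
  fixes z :: complex
  assumes "r \<ge> 1"
  shows "(\<Prod>i<r - 1. z - 1 - of_nat i) = (\<Sum>l = 1..r. signed_stirling r l * z ^ (l - 1))"
  using arg_cong[OF prod_shifted_factorial_eq_sum_poly[OF assms, of z], of "\<lambda>p. poly p 0"]
  by (simp add: poly_prod poly_sum of_nat_poly)

text \<open>Since \<open>l/(j+1)\<close> times \<open>(l-1 choose j)\<close> is \<open>(l choose j+1)\<close>, the sum is \<open>-\<beta>\<^sub>l(z)/l\<close>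
  with the term \<open>z\<^sup>l\<close> of \<open>\<beta>\<^sub>l\<close>, the one coming from \<open>B\<^sub>0\<close>, left out.\<close>

lemma bernoulli_functional_power:
  assumes "1 \<le> l" "l \<le> r"
  shows "(\<Sum>j = 0..r - 1. bernoulli (j + 1) / of_nat (j + 1) * coeff ([:z, -1:] ^ (l - 1)) j)
           = (z ^ l - poly (bernoulli_shift_poly l) z) / of_nat l"
proof -
  obtain k where k: "l = Suc k" using assms by (cases l) auto
  have B0: "bernoulli 0 = 1"
    using arg_cong[OF bernoulli_generating_function, of "\<lambda>f. fps_nth f 1"]
    by (simp add: fps_mult_nth)
  have term_eq: "bernoulli (j + 1) / of_nat (j + 1) * coeff ([:z, -1:] ^ k) j
      = - (of_nat (l choose Suc j) * (-1) ^ Suc j * bernoulli (Suc j) * z ^ (l - Suc j)) / of_nat l"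
    if "j \<le> k" for j
  proof -
    have "of_nat (Suc j) * of_nat (l choose Suc j) = (of_nat l * of_nat (k choose j) :: complex)"
      unfolding k by (simp only: of_nat_mult[symmetric] Suc_times_binomial)
    hence "of_nat (k choose j) / of_nat (Suc j) = (of_nat (l choose Suc j) / of_nat l :: complex)"
      by (simp add: k field_simps del: of_nat_Suc binomial_Suc_Suc)
    moreover have "bernoulli (j + 1) / of_nat (j + 1) * coeff ([:z, -1:] ^ k) j
        = of_nat (k choose j) / of_nat (Suc j) * (bernoulli (Suc j) * (-1) ^ j * z ^ (k - j))"
      using that by (simp add: coeff_linear_poly_power del: of_nat_Suc)
    ultimately show ?thesis by (simp add: k del: of_nat_Suc binomial_Suc_Suc)
  qed
  have high: "coeff ([:z, -1:] ^ k) j = 0" if "j > k" for j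
    using degree_power_le[of "[:z, -1:]" k] that by (intro coeff_eq_0) simp
  have "(\<Sum>j = 0..r - 1. bernoulli (j + 1) / of_nat (j + 1) * coeff ([:z, -1:] ^ (l - 1)) j)
      = (\<Sum>j\<le>k. bernoulli (j + 1) / of_nat (j + 1) * coeff ([:z, -1:] ^ k) j)"
    using assms by (intro sum.mono_neutral_cong_right) (auto simp: k high)
  also have "\<dots> = (\<Sum>j\<le>k. - (of_nat (l choose Suc j) * (-1) ^ Suc j * bernoulli (Suc j)
                            * z ^ (l - Suc j)) / of_nat l)"
    by (intro sum.cong refl term_eq) simp
  also have "\<dots> = - (\<Sum>j\<le>k. of_nat (l choose Suc j) * (-1) ^ Suc j * bernoulli (Suc j)
                            * z ^ (l - Suc j)) / of_nat l"
    by (simp only: sum_divide_distrib[symmetric] sum_negf)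
  also have "\<dots> = (z ^ l - poly (bernoulli_shift_poly l) z) / of_nat l"
    unfolding poly_bernoulli_shift_poly k sum.atMost_Suc_shift by (simp add: B0)
  finally show ?thesis .
qed

text \<open>The indefinite sum of \<open>P(z)/z\<close>, computed in two ways: in the basis of falling factorials and
  in the basis of powers.\<close>

lemma falling_factorial_eq_bernoulli_sum:
  fixes z :: complex
  assumes "r \<ge> 1"
  shows "(\<Prod>i<r. z - of_nat i) / of_nat r
           = (\<Sum>l = 1..r. signed_stirling r l / of_nat l
                * (poly (bernoulli_shift_poly l) z - (-1) ^ l * bernoulli l))"
proof -
  obtain k where k: "r = Suc k" using assms by (cases r) auto
  define p :: "complex poly" where "p = smult (1 / of_nat r) (\<Prod>i<r. [:0, 1:] - of_nat i)"
  define q where "q = (\<Sum>l = 1..r. smult (signed_stirling r l / of_nat l)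
                        (bernoulli_shift_poly l - [:(-1) ^ l * bernoulli l:]))"
  have p: "poly p x = (\<Prod>i<r. x - of_nat i) / of_nat r" for x
    by (simp add: p_def poly_prod of_nat_poly)
  have q: "poly q x = (\<Sum>l = 1..r. signed_stirling r l / of_nat l
             * (poly (bernoulli_shift_poly l) x - (-1) ^ l * bernoulli l))" for x
    by (simp add: q_def poly_sum)
  have "p = q"
  proof (rule poly_eq_if_diff_eq)
    fix x :: complex
    have "(\<Prod>i<r. x - of_nat i) = x * (\<Prod>i<k. x - 1 - of_nat i)"
      unfolding k prod.lessThan_Suc_shift by (simp add: diff_diff_eq)
    moreover have "(\<Prod>i<r. x - 1 - of_nat i) = (\<Prod>i<k. x - 1 - of_nat i) * (x - of_nat r)"
      by (simp add: k algebra_simps)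
    ultimately have "poly p x - poly p (x - 1) = (\<Prod>i<k. x - 1 - of_nat i)"
      using assms by (simp add: p field_simps)
    also have "\<dots> = (\<Sum>l = 1..r. signed_stirling r l * x ^ (l - 1))"
      using prod_pred_eq_sum_stirling[OF assms, of x] by (simp add: k)
    also have "\<dots> = (\<Sum>l = 1..r. signed_stirling r l / of_nat l
        * (poly (bernoulli_shift_poly l) x - poly (bernoulli_shift_poly l) (x - 1)))"
      by (intro sum.cong refl) (simp add: bernoulli_shift_poly_diff)
    also have "\<dots> = poly q x - poly q (x - 1)"
      by (simp add: q sum_subtractf[symmetric] right_diff_distrib)
    finally show "poly p x - poly p (x - 1) = poly q x - poly q (x - 1)" .
  next
    show "poly p 0 = poly q 0"
      using assms by (simp add: p q poly_bernoulli_shift_poly_0 prod_zero_iff)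
  qed
  thus ?thesis by (simp only: p[symmetric] q[symmetric])
qed

theorem mainTheorem3:
  fixes r :: nat
  assumes "r \<ge> 1"
  shows "\<forall>z :: complex. Q r z = (-1) ^ r * psi r z"
proof
  fix z :: complex
  let ?\<beta> = "\<lambda>l. poly (bernoulli_shift_poly l) z"
  let ?b = "\<lambda>j. bernoulli (j + 1) / of_nat (j + 1)"
  let ?c = "\<lambda>l j. coeff ([:z, -1:] ^ (l - 1)) j"
  have "(\<Sum>j = 0..r - 1. ?b j * G r j (z - 1))
      = (\<Sum>j = 0..r - 1. \<Sum>l = 1..r. 1 / fact (r - 1) * (signed_stirling r l * (?b j * ?c l j)))"
    unfolding G_def prod_shifted_factorial_eq_sum_poly[OF assms]
    by (simp add: coeff_sum sum_distrib_left sum_divide_distrib mult_ac)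
  also have "\<dots> = (\<Sum>l = 1..r. \<Sum>j = 0..r - 1.
                    1 / fact (r - 1) * (signed_stirling r l * (?b j * ?c l j)))"
    by (rule sum.swap)
  also have "\<dots> = 1 / fact (r - 1) * (\<Sum>l = 1..r. signed_stirling r l * (\<Sum>j = 0..r - 1. ?b j * ?c l j))"
    by (simp only: sum_distrib_left)
  also have "\<dots> = 1 / fact (r - 1) * (\<Sum>l = 1..r. signed_stirling r l * ((z ^ l - ?\<beta> l) / of_nat l))"
    by (intro arg_cong2[of _ _ _ _ "(*)"] sum.cong refl bernoulli_functional_power) simp_all
  also have "\<dots> = 1 / fact (r - 1) * (\<Sum>l = 1..r. signed_stirling r l / of_nat l * (z ^ l - ?\<beta> l))"
    by simp
  finally have functional: "(\<Sum>j = 0..r - 1. ?b j * G r j (z - 1)) = \<dots>" .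
  have "z gchoose r = 1 / fact (r - 1) * ((\<Prod>i<r. z - of_nat i) / of_nat r)"
    using assms by (simp add: gbinomial_prod_rev atLeast0LessThan fact_reduce[of r] mult_ac)
  also have "\<dots> = 1 / fact (r - 1) * (\<Sum>l = 1..r. signed_stirling r l / of_nat l
                    * (?\<beta> l - (-1) ^ l * bernoulli l))"
    by (simp only: falling_factorial_eq_bernoulli_sum[OF assms])
  finally have "psi r z = 1 / fact (r - 1) * (\<Sum>l = 1..r. signed_stirling r l / of_nat l
                    * (z ^ l - (-1) ^ l * bernoulli l))"
    unfolding psi_def functional
    by (simp only: distrib_left[symmetric] sum.distrib[symmetric]) simp
  thus "Q r z = (-1) ^ r * psi r z" by (simp add: Q_def)
qed

end
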